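(* Let $\{f_n\}_{n\ge1}$ and $f$ be probability density functions on $\mathbb{R}^d$ such that $f_n\to f$ in Lebesgue measure and $H(f)$ is finite. If there are constants $C_1,C_2,\beta>0$ such that, for all $n$, $f_n(x)\le C_1$ and $\int_{\mathbb{R}^d}\lvert x\rvert^\beta f_n(x)\,dx\le C_2$, then $H(f_n)\to H(f)$.
   Context: A probability density function (pdf) on $\mathbb{R}^d$ is a measurable $f:\mathbb{R}^d\to[0,\infty)$ with $\int f\,dx=1$. The differential entropy is $H(f)=-\int_{\mathbb{R}^d} f\log f\,dx$, with natural logarithm and the convention $0\log0=0$. "$H(f)$ finite" means $f\log f\in L^1(\mathbb{R}^d)$. $\lvert x\rvert$ is the Euclidean norm. *)

theory Defs
  imports "HOL-Analysis.Analysis"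
begin

definition is_pdf :: "('a::euclidean_space \<Rightarrow> real) \<Rightarrow> bool" where
  "is_pdf f \<longleftrightarrow>
     f \<in> borel_measurable lebesgue \<and> (\<forall>x. 0 \<le> f x) \<and> has_bochner_integral lebesgue f 1"

text \<open>The convention \<open>0 log 0 = 0\<close> holds automatically, since \<open>0 * ln 0 = 0\<close>. The integral defining
  \<open>diff_entropy\<close> is the Bochner integral, which has the default value 0 when \<open>f log f\<close> is not
  integrable; \<open>diff_entropy f\<close> is meaningful only together with \<open>finite_diff_entropy f\<close>.\<close>

definition finite_diff_entropy :: "('a::euclidean_space \<Rightarrow> real) \<Rightarrow> bool" where
  "finite_diff_entropy f \<longleftrightarrow> integrable lebesgue (\<lambda>x. f x * ln (f x))"

definition diff_entropy :: "('a::euclidean_space \<Rightarrow> real) \<Rightarrow> real" where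
  "diff_entropy f = - (\<integral>x. f x * ln (f x) \<partial>lebesgue)"

definition tendsto_in_measure ::
    "'a measure \<Rightarrow> (nat \<Rightarrow> 'a \<Rightarrow> real) \<Rightarrow> ('a \<Rightarrow> real) \<Rightarrow> bool" where
  "tendsto_in_measure M g f \<longleftrightarrow>
     (\<forall>\<epsilon>>0. (\<lambda>n. emeasure M {x \<in> space M. \<epsilon> \<le> \<bar>g n x - f x\<bar>}) \<longlonglongrightarrow> 0)"

end

theory Submission
  imports Defs "HOL-Real_Asymp.Real_Asymp"
begin

text \<open>Along a subsequence, \<open>fn\<close> converges almost everywhere and \<open>\<integral> fn ln fn\<close> converges to some
  \<open>l\<close>; it suffices to identify \<open>l\<close>. Fatou's lemma applied to \<open>fn ln C1 - fn ln fn \<ge> 0\<close> gives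
  \<open>\<integral> f ln f \<ge> l\<close>. Conversely, Young's inequality \<open>t ln t + t a + exp (- a) \<ge> 0\<close> with
  \<open>a = \<gamma> |x|^\<beta>\<close> allows Fatou's lemma to be applied to \<open>fn ln fn + \<gamma> |x|^\<beta> fn + exp (- \<gamma> |x|^\<beta>)\<close>. As
  the last summand is integrable and independent of \<open>n\<close>, this yields
  \<open>\<integral> f ln f \<le> \<gamma> C2 + l\<close> for every \<open>\<gamma> > 0\<close>.\<close>

section \<open>Subsequences and convergence in measure\<close>

text \<open>Otherwise some subsequence stays at distance at least \<open>e\<close> from
  \<open>L\<close>; by boundedness it has a convergent further subsequence, whose limit must be
  \<open>L\<close>, a contradiction.\<close>

lemma LIMSEQ_if_subseq_limits_eq:
  fixes X :: "nat \<Rightarrow> 'a::heine_borel"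
  assumes bdd: "bounded (range X)"
    and lim: "\<And>r l. strict_mono r \<Longrightarrow> (X \<circ> r) \<longlonglongrightarrow> l \<Longrightarrow> l = L"
  shows "X \<longlonglongrightarrow> L"
proof (rule ccontr)
  assume "\<not> X \<longlonglongrightarrow> L"
  then obtain e where e: "e > 0" and "\<not> (\<forall>\<^sub>F n in sequentially. dist (X n) L < e)"
    unfolding tendsto_iff by auto
  then have "\<exists>\<^sub>\<infinity>n. \<not> dist (X n) L < e"
    by (simp add: not_eventually cofinite_eq_sequentially)
  then have "infinite {n. \<not> dist (X n) L < e}"
    by (simp add: frequently_cofinite)
  then obtain r :: "nat \<Rightarrow> nat" where r: "strict_mono r" "\<And>n. \<not> dist (X (r n)) L < e"
    using infinite_enumerate by (metis (no_types, lifting) mem_Collect_eq)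
  have "bounded (range (X \<circ> r))"
    by (rule bounded_subset[OF bdd]) auto
  then obtain l s where s: "strict_mono s" "((X \<circ> r) \<circ> s) \<longlonglongrightarrow> l"
    using bounded_imp_convergent_subsequence by blast
  then have "l = L"
    by (intro lim[of "r \<circ> s"]) (auto simp: strict_mono_o r o_assoc)
  then have "\<forall>\<^sub>F n in sequentially. dist (((X \<circ> r) \<circ> s) n) L < e"
    using s(2) e by (simp add: tendsto_iff)
  then show False
    using r(2) by (auto simp: eventually_sequentially)
qed

lemma tendsto_in_measure_subseq:
  assumes "tendsto_in_measure M g f" "strict_mono r"
  shows "tendsto_in_measure M (g \<circ> r) f"
  unfolding tendsto_in_measure_def
proof (intro allI impI)
  fix \<epsilon> :: real assume "\<epsilon> > 0"
  then have "(\<lambda>n. emeasure M {x \<in> space M. \<epsilon> \<le> \<bar>g n x - f x\<bar>}) \<longlonglongrightarrow> 0"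
    using assms(1) by (simp add: tendsto_in_measure_def)
  from LIMSEQ_subseq_LIMSEQ[OF this assms(2)]
  show "(\<lambda>n. emeasure M {x \<in> space M. \<epsilon> \<le> \<bar>(g \<circ> r) n x - f x\<bar>}) \<longlonglongrightarrow> 0"
    by (simp add: o_def)
qed

text \<open>Riesz's argument: choose indices so that the set where the \<open>k\<close>-th deviation
  is at least \<open>(1/2)^k\<close> has measure below \<open>(1/2)^k\<close>. By Borel-Cantelli
  almost every point lies in only finitely many of these sets.\<close>

lemma tendsto_in_measure_AE_subseq:
  assumes lim: "tendsto_in_measure M g f"
    and [measurable]: "\<And>n. g n \<in> borel_measurable M" "f \<in> borel_measurable M"
  obtains r :: "nat \<Rightarrow> nat"
  where "strict_mono r" "AE x in M. (\<lambda>n. g (r n) x) \<longlonglongrightarrow> f x"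
proof -
  define A where "A k n = {x \<in> space M. (1/2)^k \<le> \<bar>g n x - f x\<bar>}" for k n :: nat
  have A[measurable]: "A k n \<in> sets M" for k n
    unfolding A_def by measurable
  have "\<exists>N. \<forall>n\<ge>N. emeasure M (A k n) < ennreal ((1/2)^k)" for k
  proof -
    have "(\<lambda>n. emeasure M (A k n)) \<longlonglongrightarrow> 0"
      using lim unfolding tendsto_in_measure_def A_def by simp
    then have "\<forall>\<^sub>F n in sequentially. emeasure M (A k n) < ennreal ((1/2)^k)"
      by (rule order_tendstoD) (simp add: ennreal_zero_less_divide)
    then show ?thesis
      by (simp add: eventually_sequentially)
  qed
  then obtain N where N: "\<And>k n. n \<ge> N k \<Longrightarrow> emeasure M (A k n) < ennreal ((1/2)^k)"
    by metis
  \<comment> \<open>The sum dominates \<open>N k\<close>, and the added \<open>k\<close> makes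
    \<open>r\<close> strictly increasing even where \<open>N\<close> vanishes.\<close>
  define r where "r k = (\<Sum>i\<le>k. N i) + k" for k
  have r: "strict_mono r"
    by (simp add: strict_mono_Suc_iff r_def)
  have "N k \<le> r k" for k
    unfolding r_def by (simp add: member_le_sum trans_le_add1)
  then have less: "emeasure M (A k (r k)) < ennreal ((1/2)^k)" for k
    using N by blast
  have "measure M (A k (r k)) \<le> (1/2)^k" for k
    unfolding measure_def using less[of k] by (intro enn2real_leI) auto
  then have "summable (\<lambda>k. measure M (A k (r k)))"
    by (intro summable_comparison_test[OF _ summable_geometric[of "1/2"]]) auto
  moreover have "emeasure M (A k (r k)) < \<infinity>" for k
    using less[of k] by (auto intro: less_trans)
  ultimately have "AE x in M. \<forall>\<^sub>F k in sequentially. x \<in> space M - A k (r k)"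
    by (intro borel_cantelli_AE1) auto
  then have "AE x in M. (\<lambda>k. g (r k) x) \<longlonglongrightarrow> f x"
  proof eventually_elim
    case (elim x)
    have "\<forall>\<^sub>F k in sequentially. norm (g (r k) x - f x) \<le> (1/2)^k"
      using elim by eventually_elim (auto simp: A_def)
    moreover have "(\<lambda>k. (1/2::real)^k) \<longlonglongrightarrow> 0"
      by (rule LIMSEQ_power_zero) simp
    ultimately show ?case
      by (subst LIM_zero_iff[symmetric]) (rule Lim_null_comparison)
  qed
  with r show ?thesis
    using that by blast
qed

text \<open>The convergent sequence \<open>a\<close> only bounds the integrals from above, so it can
  absorb a moment for which nothing but an upper bound is known.\<close>

lemma fatou_integral:
  fixes u :: "nat \<Rightarrow> 'a \<Rightarrow> real"
  assumes int: "\<And>n. integrable M (u n)" and nn: "\<And>n x. 0 \<le> u n x"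
    and [measurable]: "v \<in> borel_measurable M"
    and lim: "AE x in M. (\<lambda>n. u n x) \<longlonglongrightarrow> v x"
    and le: "\<And>n. integral\<^sup>L M (u n) \<le> a n" and a: "a \<longlonglongrightarrow> l"
  shows "integrable M v" "integral\<^sup>L M v \<le> l"
proof -
  have [measurable]: "u n \<in> borel_measurable M" for n
    using int by auto
  have v: "AE x in M. 0 \<le> v x"
    using lim by eventually_elim (auto intro: LIMSEQ_le_const nn)
  have "0 \<le> integral\<^sup>L M (u n)" for n
    by (simp add: nn)
  then have "0 \<le> a n" for n
    using le order_trans by blast
  \<comment> \<open>Since \<open>ennreal\<close> sends negative reals to 0, a bound by
    \<open>ennreal l\<close> gives back a bound by \<open>l\<close> only for nonnegative
    \<open>l\<close>.\<close>
  then have l: "0 \<le> l"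
    using a by (intro LIMSEQ_le_const) auto
  have "(\<integral>\<^sup>+ x. v x \<partial>M) = (\<integral>\<^sup>+ x. liminf (\<lambda>n. ennreal (u n x)) \<partial>M)"
  proof (rule nn_integral_cong_AE)
    show "AE x in M. ennreal (v x) = liminf (\<lambda>n. ennreal (u n x))"
      using lim
    proof eventually_elim
      case (elim x)
      then have "(\<lambda>n. ennreal (u n x)) \<longlonglongrightarrow> ennreal (v x)"
        by (rule tendsto_ennrealI)
      then show ?case
        by (simp add: lim_imp_Liminf)
    qed
  qed
  also have "\<dots> \<le> liminf (\<lambda>n. \<integral>\<^sup>+ x. u n x \<partial>M)"
    by (rule nn_integral_liminf) measurable
  also have "\<dots> \<le> liminf (\<lambda>n. ennreal (a n))"
    using le by (intro Liminf_mono always_eventually allI)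
      (simp add: nn_integral_eq_integral int nn ennreal_leI)
  also have "\<dots> = ennreal l"
    by (intro lim_imp_Liminf tendsto_ennrealI a) simp
  finally have fin: "(\<integral>\<^sup>+ x. v x \<partial>M) \<le> ennreal l" .
  then show "integrable M v"
    by (intro integrableI_nonneg v) (auto simp: le_less_trans)
  show "integral\<^sup>L M v \<le> l"
    using integral_real_bounded[OF l fin] .
qed

section \<open>Integrability of the exponential weight\<close>

text \<open>On the shell between radii \<open>k\<close> and \<open>k + 1\<close> the function is at
  most \<open>w k\<close>, and the shell lies in a ball of volume
  \<open>V * (real k + 1) ^ ?d\<close>. The resulting series converges because the exponential beats
  every polynomial, however small \<open>b\<close> is.\<close>

lemma integrable_exp_minus_norm_powr:
  fixes c b :: real
  assumes c: "c > 0" and b: "b > 0"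
  shows "integrable lebesgue (\<lambda>x::'a::euclidean_space. exp (- c * norm x powr b))"
proof -
  let ?d = "DIM('a)"
  define w where "w k = exp (- c * real k powr b)" for k
  define V where "V = unit_ball_vol (real ?d)"
  have V: "0 \<le> V"
    unfolding V_def by simp
  have pt: "ennreal (exp (- c * norm x powr b))
      \<le> (\<Sum>k. ennreal (w k) * indicator (cball 0 (real k + 1)) x)" for x :: 'a
  proof -
    define F where "F j = ennreal (w j) * indicator (cball 0 (real j + 1)) x" for j
    \<comment> \<open>The index of the shell containing \<open>x\<close>; this single term of the
      series already dominates the function at \<open>x\<close>.\<close>
    define k where "k = nat \<lfloor>norm x\<rfloor>"
    have "real k = \<lfloor>norm x\<rfloor>"
      by (simp add: k_def)
    then have k: "real k \<le> norm x" "norm x \<le> real k + 1"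
      by linarith+
    then have "ennreal (exp (- c * norm x powr b)) \<le> F k"
      using c b by (auto simp: w_def F_def intro!: ennreal_leI powr_mono2)
    also have "\<dots> \<le> (\<Sum>j. F j)"
      using sum_le_suminf[of F "{k}"] by simp
    finally show ?thesis
      unfolding F_def .
  qed
  have "(\<lambda>k. (real k + 1) ^ ?d * exp (- c * real k powr b)) \<in> O(\<lambda>k. 1 / real k ^ 2)"
    using c b by real_asymp
  then have "summable (\<lambda>k. (real k + 1) ^ ?d * w k)"
    unfolding w_def
    by (rule summable_comparison_test_bigo[rotated])
      (use inverse_power_summable[of 2, where 'a=real] in \<open>simp add: field_simps\<close>)
  then have summ: "summable (\<lambda>k. V * ((real k + 1) ^ ?d * w k))"
    by (rule summable_mult)
  have "(\<integral>\<^sup>+ x. ennreal (exp (- c * norm x powr b)) \<partial>(lborel :: 'a measure))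
      \<le> (\<integral>\<^sup>+ x. (\<Sum>k. ennreal (w k) * indicator (cball 0 (real k + 1)) x) \<partial>(lborel :: 'a measure))"
    by (intro nn_integral_mono pt)
  also have "\<dots> = (\<Sum>k. \<integral>\<^sup>+ x. ennreal (w k) * indicator (cball 0 (real k + 1)) x \<partial>(lborel :: 'a measure))"
    by (intro nn_integral_suminf borel_measurable_times_ennreal borel_measurable_indicator) auto
  also have "\<dots> = (\<Sum>k. ennreal (V * ((real k + 1) ^ ?d * w k)))"
    by (subst nn_integral_cmult_indicator)
      (simp_all add: emeasure_cball V_def w_def ennreal_mult[symmetric] mult_ac)
  also have "\<dots> < \<infinity>"
  proof -
    have "0 \<le> V * ((real k + 1) ^ ?d * w k)" for k
      using V by (simp add: w_def)
    then have "(\<Sum>k. ennreal (V * ((real k + 1) ^ ?d * w k))) \<noteq> top"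
      using summ by (intro ennreal_suminf_neq_top)
    then show ?thesis
      by (simp only: less_top infinity_ennreal_def)
  qed
  finally have "integrable lborel (\<lambda>x::'a. exp (- c * norm x powr b))"
    by (intro integrableI_nonneg) auto
  then show ?thesis
    by (simp add: integrable_completion)
qed

section \<open>The function \<open>t * ln t\<close>\<close>

text \<open>Apply \<open>ln z \<le> z - 1\<close> at \<open>z = exp (- a) / t\<close> and multiply
  by \<open>t\<close>; the left-over term \<open>t\<close> is nonnegative.\<close>

lemma young_entropy:
  fixes t a :: real
  assumes "0 \<le> t"
  shows "0 \<le> t * ln t + t * a + exp (- a)"
proof (cases "t = 0")
  case False
  with assms have t: "t > 0" by simp
  have "ln (exp (- a) / t) \<le> exp (- a) / t - 1"
    using t by (intro ln_le_minus_one) simp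
  then have "- a - ln t \<le> exp (- a) / t - 1"
    using t by (simp add: ln_div)
  then have "t * (- a - ln t) \<le> t * (exp (- a) / t - 1)"
    using t by (intro mult_left_mono) auto
  then show ?thesis
    using t by (simp add: algebra_simps)
qed simp

text \<open>The endpoint 0 is included because densities may vanish or tend to 0; there the
  convention agrees with the limit of \<open>t * ln t\<close>.\<close>

lemma continuous_on_xlnx: "continuous_on {0..} (\<lambda>t::real. t * ln t)"
  unfolding continuous_on_def
proof
  fix t :: real assume "t \<in> {0..}"
  then consider "t = 0" | "t > 0" by fastforce
  then show "((\<lambda>t. t * ln t) \<longlongrightarrow> t * ln t) (at t within {0..})"
  proof cases
    case 1
    have "((\<lambda>t::real. t * ln t) \<longlongrightarrow> 0) (at_right 0)"
      by real_asymp
    with 1 show ?thesis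
      by (simp add: at_within_Ici_at_right)
  next
    case 2
    then show ?thesis
      by (intro tendsto_intros) auto
  qed
qed

section \<open>Convergence of the entropies\<close>

theorem corollary11:
  fixes f :: "real ^ 'd \<Rightarrow> real"
    and fn :: "nat \<Rightarrow> real ^ 'd \<Rightarrow> real"
    and C1 C2 \<beta> :: real
  assumes "\<And>n. is_pdf (fn n)"
    and "is_pdf f"
    and "tendsto_in_measure lebesgue fn f"
    and "finite_diff_entropy f"
    and "C1 > 0" and "C2 > 0" and "\<beta> > 0"
    and "\<And>n x. fn n x \<le> C1"
    and "\<And>n. (\<integral>\<^sup>+ x. ennreal (norm x powr \<beta> * fn n x) \<partial>lebesgue) \<le> ennreal C2"
  shows "(\<forall>n. finite_diff_entropy (fn n)) \<and>
         (\<lambda>n. diff_entropy (fn n)) \<longlonglongrightarrow> diff_entropy f"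
proof -
  define \<phi> where "\<phi> t = t * ln t" for t :: real
  define m where "m n x = norm x powr \<beta> * fn n x" for n x
  define E where "E \<gamma> x = exp (- \<gamma> * norm x powr \<beta>)" for \<gamma> :: real and x :: "real ^ 'd"
  \<comment> \<open>\<open>h\<close> and \<open>g\<close> are the two nonnegative functions fed to
    Fatou's lemma: \<open>h\<close> by Young's inequality, \<open>g\<close> by the bound
    \<open>C1\<close>. They contain the entropy integrand with opposite signs.\<close>
  define h where "h \<gamma> n x = \<phi> (fn n x) + \<gamma> * m n x + E \<gamma> x" for \<gamma> n x
  define g where "g n x = ln C1 * fn n x - \<phi> (fn n x)" for n x
  define I where "I n = (\<integral>x. \<phi> (fn n x) \<partial>lebesgue)" for n
  have fn_meas[measurable]: "fn n \<in> borel_measurable lebesgue" and fn_nn: "0 \<le> fn n x"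
    and fn_int: "integrable lebesgue (fn n)" and fn_1: "integral\<^sup>L lebesgue (fn n) = 1" for n x
    using assms(1)[of n] by (auto simp: is_pdf_def has_bochner_integral_iff)
  have f_meas[measurable]: "f \<in> borel_measurable lebesgue" and f_nn: "0 \<le> f x"
    and f_int: "integrable lebesgue f" and f_1: "integral\<^sup>L lebesgue f = 1" for x
    using assms(2) by (auto simp: is_pdf_def has_bochner_integral_iff)
  have \<phi>_meas[measurable]: "\<phi> \<in> borel_measurable borel"
    unfolding \<phi>_def by measurable
  have norm_meas[measurable]: "(\<lambda>x::real ^ 'd. norm x powr \<beta>) \<in> borel_measurable lebesgue"
    by (rule measurable_completion) measurable
  have f_ent: "integrable lebesgue (\<lambda>x. \<phi> (f x))"
    using assms(4) by (simp add: finite_diff_entropy_def \<phi>_def)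
  have m_nn: "0 \<le> m n x" for n x
    by (simp add: m_def fn_nn)
  have m_int: "integrable lebesgue (m n)" for n
    using assms(9)[of n] unfolding m_def
    by (intro integrableI_nonneg) (auto simp: fn_nn le_less_trans)
  have m_le: "integral\<^sup>L lebesgue (m n) \<le> C2" for n
    using assms(6) assms(9)[of n] unfolding m_def by (intro integral_real_bounded) auto
  have E_int: "integrable lebesgue (E \<gamma>)" if "\<gamma> > 0" for \<gamma>
    unfolding E_def using that assms(7) by (rule integrable_exp_minus_norm_powr)
  have h_nn: "0 \<le> h \<gamma> n x" for \<gamma> n x
    using young_entropy[of "fn n x" "\<gamma> * norm x powr \<beta>"] fn_nn
    by (simp add: h_def \<phi>_def m_def E_def mult_ac)
  have g_nn: "0 \<le> g n x" for n x
  proof (cases "fn n x = 0")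
    case False
    then have "fn n x > 0" using fn_nn[of n x] by simp
    then show ?thesis
      using assms(5,8) by (simp add: g_def \<phi>_def mult.commute mult_left_mono)
  qed (simp add: g_def \<phi>_def)
  \<comment> \<open>Nonnegativity of \<open>g\<close> bounds the integrand from above, that of
    \<open>h 1\<close> from below. The absolute value is there because \<open>ln C1\<close> may be
    negative.\<close>
  have ent: "integrable lebesgue (\<lambda>x. \<phi> (fn n x))" for n
  proof (rule Bochner_Integration.integrable_bound)
    show "integrable lebesgue (\<lambda>x. \<bar>ln C1\<bar> * fn n x + m n x + E 1 x)"
      using fn_int m_int E_int by auto
    show "AE x in lebesgue. norm (\<phi> (fn n x)) \<le> norm (\<bar>ln C1\<bar> * fn n x + m n x + E 1 x)"
    proof (rule AE_I2)
      fix x :: "real ^ 'd"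
      have "ln C1 * fn n x \<le> \<bar>ln C1\<bar> * fn n x"
        using fn_nn by (intro mult_right_mono) auto
      moreover have "0 \<le> \<bar>ln C1\<bar> * fn n x" "0 < E 1 x"
        using fn_nn by (auto simp: E_def)
      ultimately show "norm (\<phi> (fn n x)) \<le> norm (\<bar>ln C1\<bar> * fn n x + m n x + E 1 x)"
        using h_nn[of 1 n x] g_nn[of n x] m_nn[of n x] by (simp add: h_def g_def)
    qed
  qed measurable
  have h_int: "integrable lebesgue (h \<gamma> n)" if "\<gamma> > 0" for \<gamma> n
    unfolding h_def using ent m_int E_int[OF that] by auto
  have g_int: "integrable lebesgue (g n)" for n
    unfolding g_def using ent fn_int by auto
  have int_h: "integral\<^sup>L lebesgue (h \<gamma> n)
      \<le> I n + \<gamma> * C2 + integral\<^sup>L lebesgue (E \<gamma>)" if "\<gamma> > 0" for \<gamma> n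
    unfolding h_def I_def using ent[of n] m_int[of n] E_int[OF that] m_le[of n] that by simp
  have int_g: "integral\<^sup>L lebesgue (g n) = ln C1 - I n" for n
    unfolding g_def I_def using ent[of n] fn_int[of n] fn_1[of n] by simp
  \<comment> \<open>Integrating \<open>g \<ge> 0\<close> and \<open>h 1 \<ge> 0\<close> confines
    \<open>I\<close> to a compact interval, so it suffices to identify its subsequential
    limits.\<close>
  have upper: "I n \<le> ln C1" for n
    using Bochner_Integration.integral_nonneg[of lebesgue "g n", OF g_nn] int_g[of n] by simp
  have lower: "- (C2 + integral\<^sup>L lebesgue (E 1)) \<le> I n" for n
    using Bochner_Integration.integral_nonneg[of lebesgue "h 1 n", OF h_nn] int_h[of 1 n] by simp
  have bdd: "bounded (range I)"
    using upper lower by (intro bounded_subset[OF bounded_closed_interval]) auto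
  have "I \<longlonglongrightarrow> (\<integral>x. \<phi> (f x) \<partial>lebesgue)"
  proof (rule LIMSEQ_if_subseq_limits_eq[OF bdd])
    fix r l assume r: "strict_mono (r :: nat \<Rightarrow> nat)" and l: "(I \<circ> r) \<longlonglongrightarrow> l"
    \<comment> \<open>Refining \<open>r\<close> by \<open>s\<close> gains convergence almost
      everywhere and keeps the limit \<open>l\<close> of \<open>I\<close>.\<close>
    obtain s :: "nat \<Rightarrow> nat" where s: "strict_mono s"
      and lim: "AE x in lebesgue. (\<lambda>n. fn (r (s n)) x) \<longlonglongrightarrow> f x"
      using tendsto_in_measure_AE_subseq[OF tendsto_in_measure_subseq[OF assms(3) r]]
        fn_meas f_meas by (auto simp: o_def)
    have Il: "(\<lambda>n. I (r (s n))) \<longlonglongrightarrow> l"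
      using LIMSEQ_subseq_LIMSEQ[OF l s] by (simp add: o_def)
    have \<phi>_lim: "(\<lambda>n. \<phi> (u n)) \<longlonglongrightarrow> \<phi> v"
      if u: "u \<longlonglongrightarrow> v" "\<And>n. 0 \<le> u n" for u and v :: real
    proof -
      have "0 \<le> v"
        using u by (auto intro: LIMSEQ_le_const)
      then show ?thesis
        unfolding \<phi>_def
        using u by (intro continuous_on_tendsto_compose[OF continuous_on_xlnx]) auto
    qed
    \<comment> \<open>All densities have mass 1, so \<open>ln C1\<close> cancels from both
      sides.\<close>
    have "integral\<^sup>L lebesgue (\<lambda>x. ln C1 * f x - \<phi> (f x)) \<le> ln C1 - l"
    proof (rule fatou_integral)
      show "AE x in lebesgue. (\<lambda>n. g (r (s n)) x) \<longlonglongrightarrow> ln C1 * f x - \<phi> (f x)"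
        using lim unfolding g_def
        by eventually_elim (auto intro!: tendsto_intros \<phi>_lim fn_nn)
      show "(\<lambda>n. ln C1 - I (r (s n))) \<longlonglongrightarrow> ln C1 - l"
        by (intro tendsto_intros Il)
    qed (auto simp: g_int g_nn int_g)
    then have l_le: "l \<le> (\<integral>x. \<phi> (f x) \<partial>lebesgue)"
      using f_int f_1 f_ent by simp
    \<comment> \<open>The integral of \<open>E \<gamma>\<close> occurs on both sides of Fatou's
      inequality and cancels, so its growth as \<gamma> tends to 0 does no harm.\<close>
    have ge: "(\<integral>x. \<phi> (f x) \<partial>lebesgue) \<le> l + \<gamma> * C2" if \<gamma>: "\<gamma> > 0" for \<gamma>
    proof -
      define v where "v x = \<phi> (f x) + \<gamma> * (norm x powr \<beta> * f x) + E \<gamma> x" for x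
      have [measurable]: "E \<gamma> \<in> borel_measurable lebesgue"
        using E_int[OF \<gamma>] by auto
      have h_lim: "AE x in lebesgue. (\<lambda>n. h \<gamma> (r (s n)) x) \<longlonglongrightarrow> v x"
        using lim unfolding h_def v_def m_def
        by eventually_elim (auto intro!: tendsto_intros \<phi>_lim fn_nn)
      have a_lim: "(\<lambda>n. I (r (s n)) + \<gamma> * C2 + integral\<^sup>L lebesgue (E \<gamma>))
          \<longlonglongrightarrow> l + \<gamma> * C2 + integral\<^sup>L lebesgue (E \<gamma>)"
        by (intro tendsto_intros Il)
      have v_meas: "v \<in> borel_measurable lebesgue"
        unfolding v_def by measurable
      note fatou = fatou_integral[OF h_int[OF \<gamma>] h_nn v_meas h_lim int_h[OF \<gamma>] a_lim]
      have "(\<integral>x. \<phi> (f x) \<partial>lebesgue) + integral\<^sup>L lebesgue (E \<gamma>)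
          = (\<integral>x. \<phi> (f x) + E \<gamma> x \<partial>lebesgue)"
        using f_ent E_int[OF \<gamma>] by simp
      \<comment> \<open>The moment term of \<open>f\<close> is nonnegative and is dropped.\<close>
      also have "\<dots> \<le> integral\<^sup>L lebesgue v"
        using f_ent E_int[OF \<gamma>] \<gamma> f_nn
        by (intro integral_mono fatou(1)) (auto simp: v_def)
      also note fatou(2)
      finally show ?thesis by simp
    qed
    have "(\<integral>x. \<phi> (f x) \<partial>lebesgue) \<le> l"
    proof (rule field_le_epsilon)
      \<comment> \<open>With \<gamma> equal to \<open>e / C2\<close> the error term
        \<open>\<gamma> * C2\<close> is exactly \<open>e\<close>.\<close>
      fix e :: real assume "0 < e"
      then show "(\<integral>x. \<phi> (f x) \<partial>lebesgue) \<le> l + e"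
        using ge[of "e / C2"] assms(6) by simp
    qed
    with l_le show "l = (\<integral>x. \<phi> (f x) \<partial>lebesgue)"
      by simp
  qed
  then have "(\<lambda>n. diff_entropy (fn n)) \<longlonglongrightarrow> diff_entropy f"
    unfolding diff_entropy_def I_def \<phi>_def by (rule tendsto_minus)
  moreover have "finite_diff_entropy (fn n)" for n
    using ent[of n] by (simp add: finite_diff_entropy_def \<phi>_def)
  ultimately show ?thesis
    by blast
qed

end
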